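(* Let $M$ be a manifold (not assumed to be Hausdorff). If $M$ is homogeneous and Lindelöf, then $M$ is Hausdorff (and therefore metrizable).
   Context: A manifold is a topological space that is locally homeomorphic to the Euclidean space $\mathbb{R}^n$ of a fixed dimension $n$, i.e. every point has an open neighborhood homeomorphic to $\mathbb{R}^n$; neither the Hausdorff axiom nor second countability is assumed. A topological space $X$ is homogeneous if for all $x,y\in X$ there is a homeomorphism $h:X\to X$ with $h(x)=y$. A space is Lindelöf if each open cover has a countable subcover. *)

theory Defs
  imports "HOL-Analysis.Analysis"
begin

text \<open>
  Manifolds without boundary. Neither the Hausdorff axiom nor second countability is required.
  The dimension is a parameter, so it is the same at every point.
\<close>

definition manifold :: "nat \<Rightarrow> 'a topology \<Rightarrow> bool" where
  "manifold n X \<longleftrightarrow>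
     (\<forall>x \<in> topspace X. \<exists>U. openin X U \<and> x \<in> U \<and>
        subtopology X U homeomorphic_space Euclidean_space n)"

definition homogeneous_space :: "'a topology \<Rightarrow> bool" where
  "homogeneous_space X \<longleftrightarrow>
     (\<forall>x \<in> topspace X. \<forall>y \<in> topspace X. \<exists>h. homeomorphic_map X X h \<and> h x = y)"

end

theory Submission
  imports Defs
begin

text \<open>
  A Lindelof manifold is covered by countably many open charts. Any two points of a chart can be
  separated, so a point outside the frontiers of all charts of the cover can be separated from
  every other point: a chart containing the other point either contains both points or misses a
  neighbourhood of the given one. The frontiers are closed with empty interior, so by Baire's
  theorem, applied inside a single chart, such a point exists. Homogeneity carries this property
  to all points. Metrizability is then Urysohn's theorem.
\<close>

section \<open>Second countability from charts\<close>

lemma second_countable_Euclidean_space: "second_countable (Euclidean_space n)"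
proof -
  obtain B :: "(nat \<Rightarrow> real) set set" where "countable B" and B: "topological_basis B"
    using ex_countable_basis by auto
  then have "second_countable (euclidean :: (nat \<Rightarrow> real) topology)"
    unfolding second_countable_def
    by (metis open_openin topological_basisE topological_basis_open)
  then show ?thesis
    by (simp add: Euclidean_space_def euclidean_product_topology second_countable_subtopology)
qed

text \<open>Each member of the cover is open, so sets open in a member are open in \<open>X\<close>;
  the union of the countable bases of the members is therefore a countable base of
  \<open>X\<close>.\<close>

lemma second_countable_countable_open_cover:
  assumes "countable \<U>" and \<U>: "\<Union>\<U> = topspace X"
    and opn: "\<And>U. U \<in> \<U> \<Longrightarrow> openin X U"
    and sc: "\<And>U. U \<in> \<U> \<Longrightarrow> second_countable (subtopology X U)"
  shows "second_countable X"
proof -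
  have "\<forall>U\<in>\<U>. \<exists>\<B>. countable \<B> \<and> (\<forall>V\<in>\<B>. openin (subtopology X U) V) \<and>
      (\<forall>W x. openin (subtopology X U) W \<and> x \<in> W \<longrightarrow> (\<exists>V\<in>\<B>. x \<in> V \<and> V \<subseteq> W))"
    using sc by (simp add: second_countable_def)
  then obtain \<B> where cnt: "\<And>U. U \<in> \<U> \<Longrightarrow> countable (\<B> U)"
    and Bop: "\<And>U V. \<lbrakk>U \<in> \<U>; V \<in> \<B> U\<rbrakk> \<Longrightarrow> openin (subtopology X U) V"
    and base: "\<And>U W x. \<lbrakk>U \<in> \<U>; openin (subtopology X U) W; x \<in> W\<rbrakk> \<Longrightarrow> \<exists>V\<in>\<B> U. x \<in> V \<and> V \<subseteq> W"
    by metis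
  show ?thesis
    unfolding second_countable_def
  proof (intro exI conjI ballI allI impI)
    show "countable (\<Union>U\<in>\<U>. \<B> U)"
      using assms(1) cnt by blast
    show "openin X V" if "V \<in> (\<Union>U\<in>\<U>. \<B> U)" for V
      using that Bop opn openin_trans_full by blast
    fix W x
    assume W: "openin X W \<and> x \<in> W"
    then obtain U where U: "U \<in> \<U>" "x \<in> U"
      using \<U> openin_subset by blast
    then have "openin (subtopology X U) (U \<inter> W)"
      using W openin_subtopology_Int2 by blast
    then show "\<exists>V\<in>(\<Union>U\<in>\<U>. \<B> U). x \<in> V \<and> V \<subseteq> W"
      using base [of U "U \<inter> W" x] U W by blast
  qed
qed

section \<open>Metrization by embedding into a product of real lines\<close>

text \<open>Countably many Urysohn functions, one for each suitable pair of basic open sets,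
  separate points from closed sets and so embed \<open>X\<close> in a countable power of the real
  line. They exist because regularity and the Lindelof property give normality.\<close>

theorem Urysohn_metrization:
  assumes "second_countable X" "regular_space X" "Hausdorff_space X"
  shows "metrizable_space X"
proof -
  obtain \<B> where "countable \<B>" and opn: "\<And>V. V \<in> \<B> \<Longrightarrow> openin X V"
    and base: "\<And>U x. \<lbrakk>openin X U; x \<in> U\<rbrakk> \<Longrightarrow> \<exists>V\<in>\<B>. x \<in> V \<and> V \<subseteq> U"
    using assms by (auto simp: second_countable_def)
  \<comment> \<open>For such a pair the closure of \<open>U\<close> and the complement of
    \<open>V\<close> are disjoint closed sets, ready for Urysohn's lemma.\<close>
  define I where "I = {(U, V). U \<in> \<B> \<and> V \<in> \<B> \<and> X closure_of U \<subseteq> V}"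
  have "countable I"
    by (rule countable_subset [of _ "\<B> \<times> \<B>"]) (use \<open>countable \<B>\<close> in \<open>auto simp: I_def\<close>)
  have "normal_space X"
    using assms regular_Lindelof_imp_normal_space second_countable_imp_Lindelof_space by blast
  have "\<exists>f. continuous_map X euclideanreal f \<and> f ` (X closure_of (fst i)) \<subseteq> {0} \<and>
      f ` (topspace X - snd i) \<subseteq> {1}" if "i \<in> I" for i
  proof -
    have "closedin X (topspace X - snd i)" "disjnt (X closure_of (fst i)) (topspace X - snd i)"
      using that opn by (auto simp: I_def disjnt_iff)
    then show ?thesis
      using Urysohn_lemma_alt [OF \<open>normal_space X\<close> closedin_closure_of] by metis
  qed
  then obtain f where "\<forall>i\<in>I. continuous_map X euclideanreal (f i) \<and>
      f i ` (X closure_of (fst i)) \<subseteq> {0} \<and> f i ` (topspace X - snd i) \<subseteq> {1}"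
    by atomize_elim (intro bchoice ballI)
  then have f: "\<And>i. i \<in> I \<Longrightarrow> continuous_map X euclideanreal (f i)"
    and f0: "\<And>i. i \<in> I \<Longrightarrow> f i ` (X closure_of (fst i)) \<subseteq> {0}"
    and f1: "\<And>i. i \<in> I \<Longrightarrow> f i ` (topspace X - snd i) \<subseteq> {1}"
    by simp_all
  \<comment> \<open>The pair is found by nesting: a basic \<open>V\<close> inside \<open>W\<close>,
    a closed neighbourhood \<open>C\<close> of \<open>x\<close> inside \<open>V\<close> by
    regularity, and a basic \<open>U\<close> inside the interior part \<open>G\<close> of
    \<open>C\<close>.\<close>
  have sep: "\<exists>i\<in>I. f i x = 0 \<and> (\<forall>z \<in> topspace X - W. f i z = 1)"
    if W: "openin X W" "x \<in> W" for W x
  proof -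
    obtain V where V: "V \<in> \<B>" "x \<in> V" "V \<subseteq> W"
      using base [OF W] by blast
    have "neighbourhood_base_of (closedin X) X"
      using \<open>regular_space X\<close> by (simp add: neighbourhood_base_of_closedin)
    then obtain G C where "openin X G" "closedin X C" "x \<in> G" "G \<subseteq> C" "C \<subseteq> V"
      using opn [OF V(1)] V(2) unfolding neighbourhood_base_of by metis
    then obtain U where U: "U \<in> \<B>" "x \<in> U" "U \<subseteq> G"
      using base by blast
    then have "X closure_of U \<subseteq> V"
      using \<open>closedin X C\<close> \<open>G \<subseteq> C\<close> \<open>C \<subseteq> V\<close> by (meson closure_of_minimal subset_trans)
    then have "(U, V) \<in> I"
      using U V by (simp add: I_def)
    moreover have "x \<in> X closure_of U"
      using U(2) closure_of_subset [OF openin_subset [OF opn [OF U(1)]]] by blast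
    ultimately show ?thesis
      using f0 [of "(U, V)"] f1 [of "(U, V)"] V(3) by (intro bexI [of _ "(U, V)"]) auto
  qed
  define P where "P = product_topology (\<lambda>i. euclideanreal) I"
  \<comment> \<open>The restriction to \<open>I\<close> is there because points of
    \<open>product_topology\<close> are extensional functions on the index set.\<close>
  define F where "F = (\<lambda>x. \<lambda>i\<in>I. f i x)"
  have cont: "continuous_map X P F"
    unfolding P_def F_def using f by (auto simp: continuous_map_componentwise)
  have inj: "inj_on F (topspace X)"
  proof (rule inj_onI, rule ccontr)
    fix x y
    assume xy: "x \<in> topspace X" "y \<in> topspace X" "F x = F y" "x \<noteq> y"
    have "openin X (topspace X - {y})"
      using \<open>Hausdorff_space X\<close> xy by (simp add: closedin_Hausdorff_singleton openin_diff)
    then obtain i where "i \<in> I" "f i x = 0" "f i y = 1"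
      using sep [of "topspace X - {y}" x] xy by auto
    moreover have "F x i = F y i"
      using xy by simp
    ultimately show False
      by (simp add: F_def)
  qed
  have open_F: "openin (subtopology P (F ` topspace X)) (F ` W)" if W: "openin X W" for W
  proof (subst openin_subopen, intro ballI)
    fix p
    assume "p \<in> F ` W"
    then obtain x where x: "x \<in> W" "p = F x"
      by blast
    obtain i where i: "i \<in> I" "f i x = 0" and i1: "\<And>z. z \<in> topspace X - W \<Longrightarrow> f i z = 1"
      using sep [OF W x(1)] by blast
    \<comment> \<open>An open slab in coordinate \<open>i\<close>: it contains \<open>F x\<close>,
      whose coordinate is 0, and excludes the image of every point outside \<open>W\<close>, whose
      coordinate is 1.\<close>
    define T where "T = {q \<in> topspace P. q i \<in> {..<1}}"
    have "openin P T"
      unfolding T_def P_def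
      by (rule openin_continuous_map_preimage [OF continuous_map_product_projection])
        (use i in auto)
    then have "openin (subtopology P (F ` topspace X)) (F ` topspace X \<inter> T)"
      using openin_subtopology_Int2 by blast
    moreover have "p \<in> F ` topspace X \<inter> T"
      using x i openin_subset [OF W] continuous_map_image_subset_topspace [OF cont]
      by (auto simp: T_def F_def)
    moreover have "F ` topspace X \<inter> T \<subseteq> F ` W"
    proof clarify
      fix z
      assume "F z \<in> T" "z \<in> topspace X"
      then have "f i z \<noteq> 1"
        using i by (simp add: T_def F_def)
      then show "F z \<in> F ` W"
        using i1 \<open>z \<in> topspace X\<close> by blast
    qed
    ultimately show "\<exists>T. openin (subtopology P (F ` topspace X)) T \<and> p \<in> T \<and> T \<subseteq> F ` W"
      by blast
  qed
  have "homeomorphic_map X (subtopology P (F ` topspace X)) F"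
  proof (rule bijective_open_imp_homeomorphic_map)
    show "continuous_map X (subtopology P (F ` topspace X)) F"
      using cont by (simp add: continuous_map_in_subtopology)
    show "open_map X (subtopology P (F ` topspace X)) F"
      by (simp add: open_map_def open_F)
    show "F ` topspace X = topspace (subtopology P (F ` topspace X))"
      using continuous_map_image_subset_topspace [OF cont] by auto
  qed (rule inj)
  \<comment> \<open>Countability of the index set enters here, and it comes from the countable
    base.\<close>
  moreover have "metrizable_space P"
    unfolding P_def metrizable_space_product_topology
    using \<open>countable I\<close> by (auto simp: metrizable_space_euclidean)
  ultimately show ?thesis
    using homeomorphic_map_imp_homeomorphic_space homeomorphic_metrizable_space
      metrizable_space_subtopology by blast
qed

section \<open>Frontiers, Baire category and separation of points\<close>

text \<open>A nonempty open set inside the frontier would consist of closure points of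
  \<open>S\<close> and hence meet \<open>S\<close>, but an open set is disjoint from its
  frontier.\<close>

lemma interior_of_frontier_of_openin:
  assumes "openin X S"
  shows "X interior_of (X frontier_of S) = {}"
  unfolding interior_of_eq_empty
proof (intro allI impI, rule ccontr)
  fix T
  assume "openin X T \<and> T \<subseteq> X frontier_of S" "T \<noteq> {}"
  then have "T \<inter> S \<noteq> {}" "T \<inter> S = {}"
    using frontier_of_openin_straddle_Int(1) [of X T S] frontier_of_openin [OF assms] by blast+
  then show False ..
qed

text \<open>The whole space need not be metrizable, so Baire's theorem is applied in
  \<open>U\<close> to the traces of the frontiers, which are closed in \<open>U\<close> and nowhere
  dense.\<close>

lemma exists_point_outside_frontiers:
  assumes "openin X U" "U \<noteq> {}" "completely_metrizable_space (subtopology X U)"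
    and "countable \<V>" and opn: "\<And>V. V \<in> \<V> \<Longrightarrow> openin X V"
  obtains x where "x \<in> U" "\<And>V. V \<in> \<V> \<Longrightarrow> x \<notin> X frontier_of V"
proof -
  let ?\<G> = "(\<lambda>V. U \<inter> X frontier_of V) ` \<V>"
  have "(subtopology X U) interior_of \<Union>?\<G> = {}"
  proof (rule Baire_category_alt)
    fix T
    assume "T \<in> ?\<G>"
    then obtain V where V: "V \<in> \<V>" "T = U \<inter> X frontier_of V"
      by blast
    \<comment> \<open>As \<open>U\<close> is open, an interior taken in \<open>U\<close> is also
      open in \<open>X\<close>, so the trace gains no interior.\<close>
    then have "(subtopology X U) interior_of T \<subseteq> X interior_of (X frontier_of V)"
      using \<open>openin X U\<close> by (auto simp: interior_of_subtopology_open interior_of_Int)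
    moreover have "closedin (subtopology X U) T"
      using V by (simp add: closedin_frontier_of closedin_subtopology_Int_closed)
    ultimately show "closedin (subtopology X U) T \<and> (subtopology X U) interior_of T = {}"
      using opn V interior_of_frontier_of_openin by blast
  qed (use assms in auto)
  moreover have "(subtopology X U) interior_of U = U"
    using \<open>openin X U\<close> by (simp add: interior_of_subtopology_open interior_of_openin)
  ultimately have "U \<noteq> \<Union>?\<G>"
    using \<open>U \<noteq> {}\<close> by metis
  then show thesis
    using that by blast
qed

lemma separated_outside_frontiers:
  assumes \<V>: "\<Union>\<V> = topspace X"
    and opn: "\<And>V. V \<in> \<V> \<Longrightarrow> openin X V"
    and haus: "\<And>V. V \<in> \<V> \<Longrightarrow> Hausdorff_space (subtopology X V)"
    and x: "x \<in> topspace X" "\<And>V. V \<in> \<V> \<Longrightarrow> x \<notin> X frontier_of V"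
    and y: "y \<in> topspace X" "y \<noteq> x"
  shows "\<exists>S T. openin X S \<and> openin X T \<and> x \<in> S \<and> y \<in> T \<and> disjnt S T"
proof -
  \<comment> \<open>The set is chosen around \<open>y\<close>, not \<open>x\<close>: if it misses
    \<open>x\<close>, the frontier hypothesis puts \<open>x\<close> outside its closure.\<close>
  obtain V where V: "V \<in> \<V>" "y \<in> V"
    using \<V> y by blast
  show ?thesis
  proof (cases "x \<in> V")
    case True
    then have "x \<in> topspace (subtopology X V)" "y \<in> topspace (subtopology X V)"
      using V(2) x(1) y(1) by simp_all
    then obtain S T where "openin (subtopology X V) S" "openin (subtopology X V) T"
      "x \<in> S" "y \<in> T" "disjnt S T"
      using haus [OF V(1)] y(2) unfolding Hausdorff_space_def by metis
    then show ?thesis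
      using openin_trans_full [OF _ opn [OF V(1)]] by blast
  next
    case False
    then have "x \<in> topspace X - X closure_of V"
      using x(1) x(2) [OF V(1)] opn [OF V(1)] by (simp add: frontier_of_openin)
    moreover have "openin X (topspace X - X closure_of V)"
      by (simp add: openin_diff)
    moreover have "disjnt (topspace X - X closure_of V) V"
      using closure_of_subset [OF openin_subset [OF opn [OF V(1)]]] by (auto simp: disjnt_iff)
    ultimately show ?thesis
      using V(2) opn [OF V(1)] by blast
  qed
qed

text \<open>Given \<open>a\<close> and \<open>b\<close>, a homeomorphism moves \<open>a\<close> to
  \<open>x\<close> and, being injective, moves \<open>b\<close> elsewhere; separating open sets for
  the images pull back to separating open sets for \<open>a\<close> and \<open>b\<close>.\<close>

lemma homogeneous_space_imp_Hausdorff_space: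
  assumes "homogeneous_space X" and x: "x \<in> topspace X"
    and sep: "\<And>y. \<lbrakk>y \<in> topspace X; y \<noteq> x\<rbrakk> \<Longrightarrow>
      \<exists>S T. openin X S \<and> openin X T \<and> x \<in> S \<and> y \<in> T \<and> disjnt S T"
  shows "Hausdorff_space X"
  unfolding Hausdorff_space_def
proof (intro allI impI)
  fix a b
  assume ab: "a \<in> topspace X \<and> b \<in> topspace X \<and> a \<noteq> b"
  then obtain h where h: "homeomorphic_map X X h" "h a = x"
    using assms unfolding homogeneous_space_def by blast
  then have "h b \<in> topspace X" "h b \<noteq> x"
    using ab homeomorphic_imp_injective_map [OF h(1)] homeomorphic_imp_surjective_map [OF h(1)]
    by (auto dest: inj_onD)
  then obtain S T where ST: "openin X S" "openin X T" "x \<in> S" "h b \<in> T" "disjnt S T"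
    using sep by blast
  have pre: "openin X {z \<in> topspace X. h z \<in> W}" if "openin X W" for W
    using openin_continuous_map_preimage [OF homeomorphic_imp_continuous_map [OF h(1)] that] .
  have "disjnt {z \<in> topspace X. h z \<in> S} {z \<in> topspace X. h z \<in> T}"
    using ST(5) by (auto simp: disjnt_iff)
  then show "\<exists>U V. openin X U \<and> openin X V \<and> a \<in> U \<and> b \<in> V \<and> disjnt U V"
    using pre [OF ST(1)] pre [OF ST(2)] ST h(2) ab by blast
qed

section \<open>From charts to the whole manifold\<close>

text \<open>Compactness of a set does not depend on the ambient space, so compact neighbourhoods in
  a chart serve in \<open>X\<close>. Combined with the Hausdorff property this later yields
  regularity.\<close>

lemma manifold_imp_locally_compact_space:
  assumes "manifold n X"
  shows "locally_compact_space X"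
  unfolding locally_compact_space_def
proof
  fix x
  assume "x \<in> topspace X"
  then obtain U where U: "openin X U" "x \<in> U" "subtopology X U homeomorphic_space Euclidean_space n"
    using assms unfolding manifold_def by blast
  then have xU: "x \<in> topspace (subtopology X U)"
    using \<open>x \<in> topspace X\<close> by simp
  have "locally_compact_space (subtopology X U)"
    using U(3) homeomorphic_locally_compact_space locally_compact_Euclidean_space by blast
  then obtain V K where "openin (subtopology X U) V" "compactin (subtopology X U) K" "x \<in> V" "V \<subseteq> K"
    using xU unfolding locally_compact_space_def by meson
  then show "\<exists>V K. openin X V \<and> compactin X K \<and> x \<in> V \<and> V \<subseteq> K"
    using U(1) by (meson compactin_subtopology openin_trans_full)
qed

lemma Lindelof_manifold_countable_atlas:
  assumes "manifold n X" "Lindelof_space X"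
  obtains \<V> where "countable \<V>" "\<Union>\<V> = topspace X" "\<And>V. V \<in> \<V> \<Longrightarrow> openin X V"
    "\<And>V. V \<in> \<V> \<Longrightarrow> subtopology X V homeomorphic_space Euclidean_space n"
proof -
  let ?\<U> = "{U. openin X U \<and> subtopology X U homeomorphic_space Euclidean_space n}"
  have "\<Union>?\<U> = topspace X"
    using assms(1) openin_subset unfolding manifold_def by fast
  then obtain \<V> where "countable \<V>" "\<V> \<subseteq> ?\<U>" "\<Union>\<V> = topspace X"
    using Lindelof_spaceD [OF assms(2), of ?\<U>] by auto
  then show thesis
    by (intro that [of \<V>]) auto
qed

theorem theorem1p1:
  fixes M :: "'a topology" and n :: nat
  assumes "manifold n M"
    and "homogeneous_space M"
    and "Lindelof_space M"
  shows "Hausdorff_space M \<and> metrizable_space M"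
proof -
  obtain \<V> where \<V>: "countable \<V>" "\<Union>\<V> = topspace M"
    and opn: "\<And>V. V \<in> \<V> \<Longrightarrow> openin M V"
    and hom: "\<And>V. V \<in> \<V> \<Longrightarrow> subtopology M V homeomorphic_space Euclidean_space n"
    using Lindelof_manifold_countable_atlas [OF assms(1,3)] by blast
  have haus: "Hausdorff_space (subtopology M V)" if "V \<in> \<V>" for V
    using hom [OF that] homeomorphic_Hausdorff_space Hausdorff_Euclidean_space by blast
  have "Hausdorff_space M"
  \<comment> \<open>Baire's theorem needs a nonempty chart, so the empty space is treated
    apart.\<close>
  proof (cases "topspace M = {}")
    case True
    then show ?thesis
      by (simp add: Hausdorff_space_def)
  next
    case False
    then obtain U where U: "U \<in> \<V>" "U \<noteq> {}"
      using \<V>(2) by blast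
    moreover have "completely_metrizable_space (subtopology M U)"
      using hom [OF U(1)] homeomorphic_completely_metrizable_space
        completely_metrizable_Euclidean_space by blast
    ultimately obtain x where x: "x \<in> U" "\<And>V. V \<in> \<V> \<Longrightarrow> x \<notin> M frontier_of V"
      using exists_point_outside_frontiers [of M U \<V>] opn \<V>(1) by blast
    then have "x \<in> topspace M"
      using \<V>(2) U(1) by blast
    then show ?thesis
      using homogeneous_space_imp_Hausdorff_space [OF assms(2)]
        separated_outside_frontiers [OF \<V>(2) opn haus] x(2) by blast
  qed
  moreover have "second_countable (subtopology M V)" if "V \<in> \<V>" for V
    using hom [OF that] homeomorphic_space_second_countability second_countable_Euclidean_space
    by blast
  then have "second_countable M"
    using second_countable_countable_open_cover [OF \<V> opn] by blast
  \<comment> \<open>Local compactness and the Hausdorff property give regularity, the remaining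
    hypothesis for metrization.\<close>
  ultimately show ?thesis
    using Urysohn_metrization locally_compact_Hausdorff_imp_regular_space
      manifold_imp_locally_compact_space [OF assms(1)] by blast
qed

end
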